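(* Let $S:\mathbb{R}^d\to\mathbb{R}$ and let $x_t$ be a boundary point, $S(x_t)=0$, with $\nabla S(x_t)\neq 0$. Suppose $S$ is differentiable with $L$-Lipschitz gradient on a neighborhood of $x_t$ containing the closed ball of radius $\delta$ around $x_t$, where $\delta\in(0,1)$. Let $u_1,\dots,u_B$ be i.i.d. uniform on the unit sphere of $\mathbb{R}^d$, let $\phi(x)=\operatorname{sign}(S(x))$ (equal to $1$ if $S(x)>0$ and $-1$ otherwise), and define $$\widetilde{\nabla S}(x_t,\delta)=\frac1B\sum_{b=1}^B\phi(x_t+\delta u_b)\,u_b.$$ Then $$\cos\angle\big(\mathbb{E}[\widetilde{\nabla S}(x_t,\delta)],\nabla S(x_t)\big)\ \ge\ 1-\frac{9L^2\delta^2 d^2}{8\|\nabla S(x_t)\|_2^2}.$$ In particular, $$\lim_{\delta\to0}\cos\angle\big(\mathbb{E}[\widetilde{\nabla S}(x_t,\delta)],\nabla S(x_t)\big)=1.$$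
   Context: $\cos\angle(a,b)=\langle a,b\rangle/(\|a\|_2\|b\|_2)$ denotes the cosine of the angle between nonzero vectors $a,b\in\mathbb{R}^d$. *)

theory Defs
  imports "HOL-Probability.Probability"
begin

definition cos_angle :: "'a::real_inner \<Rightarrow> 'a \<Rightarrow> real" where
  "cos_angle a b = inner a b / (norm a * norm b)"

text \<open>Uniform probability distribution on the unit sphere: the image of the uniform
  distribution on the open unit ball under radial projection x \<mapsto> x/|x|,
  restricted to the sphere (which carries full mass).\<close>
definition unif_sphere :: "'a::euclidean_space measure" where
  "unif_sphere = restrict_space
     (distr (uniform_measure lborel (ball 0 1)) borel (\<lambda>x. x /\<^sub>R norm x)) (sphere 0 1)"

definition sign_phi :: "('a \<Rightarrow> real) \<Rightarrow> 'a \<Rightarrow> real" where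
  "sign_phi S x = (if S x > 0 then 1 else -1)"

definition expected_grad_est ::
  "('a::euclidean_space \<Rightarrow> real) \<Rightarrow> 'a \<Rightarrow> real \<Rightarrow> nat \<Rightarrow> 'a" where
  "expected_grad_est S xt \<delta> B =
     integral\<^sup>L (PiM {..<B} (\<lambda>_. unif_sphere))
       (\<lambda>us. (1 / real B) *\<^sub>R (\<Sum>b<B. sign_phi S (xt + \<delta> *\<^sub>R us b) *\<^sub>R us b))"

end

(*
  Write n for the normalised gradient and w = L \<delta> / (2 |grad S|). By the Lipschitz bound on the gradient,
  sign S(xt + \<delta> u) agrees with sgn (n \<bullet> u) as soon as |n \<bullet> u| > w. Let p be the measure of the slab
  |n \<bullet> u| \<le> w and A the mean of |n \<bullet> u|. The component of the expectation along n is at least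
  A - 2 w p, and by reflection symmetry only the slab contributes to the orthogonal component, whose
  norm is therefore at most p. Everything reduces to p \<le> (d + 1) w A, which is obtained by pulling
  both sides back to the unit ball and slicing it orthogonally to n.
*)
theory Submission
  imports Defs
begin

subsection \<open>Slices of the unit ball\<close>

text \<open>Only the ratio of p to A matters, so no Gamma values enter: after the pull-back to the
  ball, the volume of the (d-1)-dimensional unit ball is a factor of both and cancels. The pull-back
  needs no polar coordinates, because norm x <= 1 makes both comparisons run in the useful
  direction. The ratio is at most (d + 1) w, hence at most 3/2 x with x = d w as soon as d >= 2.
  Dimension 1, where d + 1 exceeds 3/2 d, is rescued by the slab being empty for w < 1. In terms of
  x the claimed bound reads 1 - 9/2 x^2. It is trivial for x >= 2/3. Below that, the component along
  n is positive, which settles the case where the claimed bound is <= 0; otherwise the tangent of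
  the angle is at most (3/2 x) / (1 - 3/2 x^2), and cos >= 1 - tan^2 / 2 leaves room to spare.
  Orthogonal invariance of Lebesgue measure serves twice: to turn n into a coordinate axis, and to
  reflect the sphere.\<close>

lemma distr_lborel_orthogonal_transformation:
  fixes f :: "'a::euclidean_space \<Rightarrow> 'a"
  assumes f: "orthogonal_transformation f"
  shows "distr lborel borel f = lborel"
proof (rule measure_eqI)
  show "sets (distr lborel borel f) = sets lborel"
    by simp
next
  fix A assume "A \<in> sets (distr lborel borel f)"
  then have [measurable]: "A \<in> sets borel" "ball (0::'a) 1 \<in> sets borel"
    by simp_all
  have lin: "linear f" and norm_f: "\<And>x. norm (f x) = norm x"
    using f by (auto simp: orthogonal_transformation)
  have [measurable]: "f \<in> borel_measurable borel"
    using lin by (intro borel_measurable_continuous_onI linear_continuous_on linear_conv_bounded_linear[THEN iffD1])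
  obtain g where g: "\<And>x. f (g x) = x"
    using orthogonal_transformation_surj[OF f] by (metis surj_def)
  define V where "V = emeasure lborel (ball (0::'a) 1)"
  have V: "V \<noteq> 0" "V \<noteq> \<top>"
    by (simp_all add: V_def emeasure_ball unit_ball_vol_pos less_imp_neq[symmetric])
  \<comment> \<open>Uniqueness of translation-invariant measures: the double integral of ?F is V times the
    image measure of A when x is integrated first, and V times the Lebesgue measure of A when y is.\<close>
  let ?F = "\<lambda>x y. indicator (ball 0 1) (f y - x) * (indicator A (f y) :: ennreal)"
  have shift: "(\<integral>\<^sup>+x. h (c + x) \<partial>lborel) = (\<integral>\<^sup>+x. h x \<partial>lborel)"
    if [measurable]: "h \<in> borel_measurable borel" for h :: "'a \<Rightarrow> ennreal" and c
    by (subst (2) lborel_distr_plus[of c, symmetric], subst nn_integral_distr) simp_all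
  have ball: "(\<integral>\<^sup>+x. indicator (ball 0 1) (c - x) \<partial>lborel) = V" for c :: 'a
  proof -
    have "(\<integral>\<^sup>+x. indicator (ball 0 1) (c - x) \<partial>lborel) = (\<integral>\<^sup>+x. indicator (ball c 1) x \<partial>lborel)"
      by (intro nn_integral_cong) (auto simp: indicator_def dist_norm norm_minus_commute)
    then show ?thesis
      by (simp add: V_def emeasure_ball)
  qed
  have "emeasure (distr lborel borel f) A = (\<integral>\<^sup>+y. indicator A (f y) \<partial>lborel)"
    by (subst nn_integral_indicator[symmetric], simp, subst nn_integral_distr) simp_all
  then have "V * emeasure (distr lborel borel f) A = (\<integral>\<^sup>+y. V * indicator A (f y) \<partial>lborel)"
    by (simp add: nn_integral_cmult)
  also have "\<dots> = (\<integral>\<^sup>+y. \<integral>\<^sup>+x. ?F x y \<partial>lborel \<partial>lborel)"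
  proof (intro nn_integral_cong)
    fix y
    have "(\<integral>\<^sup>+x. ?F x y \<partial>lborel) = (\<integral>\<^sup>+x. indicator (ball 0 1) (f y - x) \<partial>lborel) * indicator A (f y)"
      by (rule nn_integral_multc) measurable
    then show "V * indicator A (f y) = (\<integral>\<^sup>+x. ?F x y \<partial>lborel)"
      by (simp only: ball)
  qed
  also have "\<dots> = (\<integral>\<^sup>+x. \<integral>\<^sup>+y. ?F x y \<partial>lborel \<partial>lborel)"
    by (rule lborel_pair.Fubini') measurable
  \<comment> \<open>Translating y by the preimage \<open>g x\<close> of x turns
    \<open>f y - x\<close> into \<open>f y\<close>, whose norm is that of y. The ball condition then
    no longer mentions x or f, and x survives only as a translation inside A.\<close>
  also have "\<dots> = (\<integral>\<^sup>+x. \<integral>\<^sup>+y. ?F x (g x + y) \<partial>lborel \<partial>lborel)"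
    by (intro nn_integral_cong shift[symmetric]) measurable
  also have "\<dots> = (\<integral>\<^sup>+x. \<integral>\<^sup>+y. indicator (ball 0 1) y * indicator A (f y + x) \<partial>lborel \<partial>lborel)"
    by (intro nn_integral_cong) (simp add: linear_add[OF lin] g norm_f indicator_def add.commute)
  also have "\<dots> = (\<integral>\<^sup>+y. \<integral>\<^sup>+x. indicator (ball 0 1) y * indicator A (f y + x) \<partial>lborel \<partial>lborel)"
    by (rule lborel_pair.Fubini') measurable
  also have "\<dots> = (\<integral>\<^sup>+y. indicator (ball (0::'a) 1) y * emeasure lborel A \<partial>lborel)"
  proof (intro nn_integral_cong)
    fix y
    have "(\<integral>\<^sup>+x. indicator (ball 0 1) y * indicator A (f y + x) \<partial>lborel)
      = indicator (ball 0 1) y * (\<integral>\<^sup>+x. indicator A (f y + x) \<partial>lborel)"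
      by (rule nn_integral_cmult) measurable
    also have "(\<integral>\<^sup>+x. indicator A (f y + x) \<partial>lborel) = (\<integral>\<^sup>+x. indicator A x \<partial>lborel)"
      by (rule shift) measurable
    finally show "(\<integral>\<^sup>+x. indicator (ball 0 1) y * indicator A (f y + x) \<partial>lborel)
      = indicator (ball 0 1) y * emeasure lborel A"
      by simp
  qed
  also have "\<dots> = V * emeasure lborel A"
    by (simp add: nn_integral_multc V_def)
  finally show "emeasure (distr lborel borel f) A = emeasure lborel A"
    using V by (simp add: ennreal_mult_cancel_left)
qed

section \<open>Hyperplane reflections\<close>

definition householder :: "'a::real_inner \<Rightarrow> 'a \<Rightarrow> 'a" where
  "householder v x = x - (2 * (v \<bullet> x) / (v \<bullet> v)) *\<^sub>R v"

text \<open>For v = 0 the division by zero makes the map the identity, so no hypothesis on v is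
  needed. This spares a case distinction later when n already is the chosen basis vector.\<close>

lemma orthogonal_transformation_householder: "orthogonal_transformation (householder v)"
  unfolding orthogonal_transformation_def
proof
  show "linear (householder v)"
    by (rule linearI) (simp_all add: householder_def inner_right_distrib algebra_simps add_divide_distrib)
  show "\<forall>x y. householder v x \<bullet> householder v y = x \<bullet> y"
    by (cases "v = 0") (simp_all add: householder_def inner_diff_left inner_diff_right inner_commute field_simps)
qed

text \<open>Equal norms give (a - b) . (a - b) = 2 (a - b) . a, so the coefficient is 1 and exactly
  a - b is subtracted from a. Geometrically, 0 lies on the perpendicular bisector of a and
  b.\<close>

lemma householder_diff:
  assumes "norm a = norm b"
  shows "householder (a - b) a = b"
proof (cases "a = b")
  case False
  have "(a - b) \<bullet> (a - b) = 2 * ((a - b) \<bullet> a)"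
    using assms by (simp add: norm_eq inner_diff_left inner_diff_right inner_commute)
  moreover have "(a - b) \<bullet> (a - b) \<noteq> 0" using False by simp
  ultimately show ?thesis
    by (simp add: householder_def)
qed (simp add: householder_def)

text \<open>Fubini with the coordinate along e split off: the slice of the ball at height t is a
  ball of radius sqrt (1 - t^2) in the remaining d - 1 coordinates.\<close>

lemma nn_integral_cball_inner_Basis:
  fixes e :: "'a::euclidean_space" and h :: "real \<Rightarrow> ennreal"
  assumes e: "e \<in> Basis" and [measurable]: "h \<in> borel_measurable borel"
  shows "(\<integral>\<^sup>+x. h (e \<bullet> x) * indicator (cball 0 1) x \<partial>lborel)
    = ennreal (unit_ball_vol (DIM('a) - 1)) *
       (\<integral>\<^sup>+t. h t * (indicator {-1..1} t * ennreal (sqrt (1 - t\<^sup>2) ^ (DIM('a) - 1))) \<partial>lborel)"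
proof -
  interpret product_sigma_finite "\<lambda>_. lborel"
    by standard
  have [measurable]: "cball (0::'a) 1 \<in> sets borel"
    by simp
  define I where "I = Basis - {e}"
  define P :: "('a \<Rightarrow> real) measure" where "P = Pi\<^sub>M I (\<lambda>_. lborel)"
  have I: "Basis = insert e I" "e \<notin> I" "finite I" "card I = DIM('a) - 1"
    using e by (auto simp: I_def)
  let ?s = "\<lambda>f. \<Sum>b\<in>Basis. f b *\<^sub>R b :: 'a"
  have ball_iff: "?s f \<in> cball 0 1 \<longleftrightarrow> (f e)\<^sup>2 + (\<Sum>b\<in>I. (f b)\<^sup>2) \<le> 1" for f
  proof -
    have "norm (?s f) = sqrt (\<Sum>b\<in>Basis. (f b)\<^sup>2)"
      using euclidean_dist_l2[of 0 "?s f"] by (simp add: L2_set_def)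
    also have "(\<Sum>b\<in>Basis. (f b)\<^sup>2) = (f e)\<^sup>2 + (\<Sum>b\<in>I. (f b)\<^sup>2)"
      unfolding I(1) using I(2,3) by simp
    finally show ?thesis
      by simp
  qed
  have "(\<integral>\<^sup>+x. h (e \<bullet> x) * indicator (cball 0 1) x \<partial>lborel)
     = (\<integral>\<^sup>+f. h (f e) * indicator {f. (f e)\<^sup>2 + (\<Sum>b\<in>I. (f b)\<^sup>2) \<le> 1} f \<partial>Pi\<^sub>M (insert e I) (\<lambda>_. lborel))"
    unfolding I(1)[symmetric]
    apply (subst lborel_eq)
    apply (subst nn_integral_distr)
      apply measurable
    apply (intro nn_integral_cong)
    using e ball_iff by (auto simp: indicator_def inner_sum_right inner_Basis if_distrib cong: if_cong)
  also have "\<dots> = (\<integral>\<^sup>+t. \<integral>\<^sup>+f. h t * indicator {f. t\<^sup>2 + (\<Sum>b\<in>I. (f b)\<^sup>2) \<le> 1} f \<partial>P \<partial>lborel)"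
  proof -
    have *: "(\<Sum>b\<in>I. ((x(e := y)) b)\<^sup>2) = (\<Sum>b\<in>I. (x b)\<^sup>2)" for x y
      using I by (intro sum.cong) auto
    have [measurable]: "(\<lambda>f. h (f e) * indicator {f. (f e)\<^sup>2 + (\<Sum>b\<in>I. (f b)\<^sup>2) \<le> 1} f)
        \<in> borel_measurable (Pi\<^sub>M (insert e I) (\<lambda>_. lborel))"
      by (simp add: indicator_def[abs_def])
    show ?thesis
      unfolding P_def by (subst product_nn_integral_insert_rev[OF I(3,2)]) (simp_all add: indicator_def * del: fun_upd_apply, simp)
  qed
  also have "\<dots> = (\<integral>\<^sup>+t. h t * emeasure P ({f. t\<^sup>2 + (\<Sum>b\<in>I. (f b)\<^sup>2) \<le> 1} \<inter> space P) \<partial>lborel)"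
  proof (intro nn_integral_cong)
    fix t :: real
    have "(\<integral>\<^sup>+f. h t * indicator {f. t\<^sup>2 + (\<Sum>b\<in>I. (f b)\<^sup>2) \<le> 1} f \<partial>P) =
      (\<integral>\<^sup>+f. h t * indicator ({f. t\<^sup>2 + (\<Sum>b\<in>I. (f b)\<^sup>2) \<le> 1} \<inter> space P) f \<partial>P)"
      by (intro nn_integral_cong) (auto simp: indicator_def)
    also have "\<dots> = h t * emeasure P ({f. t\<^sup>2 + (\<Sum>b\<in>I. (f b)\<^sup>2) \<le> 1} \<inter> space P)"
      unfolding P_def by (subst nn_integral_cmult) auto
    finally show "(\<integral>\<^sup>+f. h t * indicator {f. t\<^sup>2 + (\<Sum>b\<in>I. (f b)\<^sup>2) \<le> 1} f \<partial>P) =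
       h t * emeasure P ({f. t\<^sup>2 + (\<Sum>b\<in>I. (f b)\<^sup>2) \<le> 1} \<inter> space P)" .
  qed
  also have "\<dots> = (\<integral>\<^sup>+t. h t * (indicator {-1..1} t * (ennreal (unit_ball_vol (card I)) * ennreal (sqrt (1 - t\<^sup>2) ^ card I))) \<partial>lborel)"
  proof (rule nn_integral_cong_AE)
    \<comment> \<open>At t = -1 and t = 1 the slice has radius 0. Without these two points, either
      the radius is positive and the volume formula for balls applies, or the slice is
      empty.\<close>
    have "AE t in lborel. t \<notin> {-1, 1::real}"
      by (intro AE_not_in countable_imp_null_set_lborel) auto
    then show "AE t in lborel. h t * emeasure P ({f. t\<^sup>2 + (\<Sum>b\<in>I. (f b)\<^sup>2) \<le> 1} \<inter> space P) =
      h t * (indicator {-1..1} t * (ennreal (unit_ball_vol (card I)) * ennreal (sqrt (1 - t\<^sup>2) ^ card I)))"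
    proof eventually_elim
      case (elim t)
      show ?case
      proof (cases "\<bar>t\<bar> < 1")
        case True
        then have t: "t\<^sup>2 < 1" by (simp add: abs_square_less_1)
        have "{f. t\<^sup>2 + (\<Sum>b\<in>I. (f b)\<^sup>2) \<le> 1} = {f. sqrt (\<Sum>b\<in>I. (f b)\<^sup>2) \<le> sqrt (1 - t\<^sup>2)}"
          by (auto simp: algebra_simps)
        then show ?thesis
          using True t I abs_less_iff[of t 1] emeasure_cball_aux[of I "sqrt (1 - t\<^sup>2)"]
          by (simp add: P_def ennreal_mult' indicator_def)
      next
        case False
        then have t: "t\<^sup>2 > 1" "t \<notin> {-1..1}"
          using elim abs_square_le_1[of t] by auto
        have "\<not> t\<^sup>2 + (\<Sum>b\<in>I. (f b)\<^sup>2) \<le> 1" for f :: "'a \<Rightarrow> real"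
          using t(1) sum_nonneg[of I "\<lambda>b. (f b)\<^sup>2"] by simp
        then have "{f. t\<^sup>2 + (\<Sum>b\<in>I. (f b)\<^sup>2) \<le> 1} = {}"
          by simp
        then show ?thesis using t by simp
      qed
    qed
  qed
  also have "\<dots> = (\<integral>\<^sup>+t. ennreal (unit_ball_vol (card I)) * (h t * (indicator {-1..1} t * ennreal (sqrt (1 - t\<^sup>2) ^ card I))) \<partial>lborel)"
    by (simp add: mult_ac)
  also have "\<dots> = ennreal (unit_ball_vol (card I)) * (\<integral>\<^sup>+t. h t * (indicator {-1..1} t * ennreal (sqrt (1 - t\<^sup>2) ^ card I)) \<partial>lborel)"
    by (rule nn_integral_cmult) measurable
  finally show ?thesis using I(4) by (simp add: of_nat_diff Suc_leI)
qed

text \<open>The reflection taking n to e preserves Lebesgue measure and the ball, and n . x = f n .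
  f x = e . f x reduces everything to the axis e.\<close>

lemma nn_integral_cball_inner:
  fixes n :: "'a::euclidean_space" and h :: "real \<Rightarrow> ennreal"
  assumes n: "norm n = 1" and [measurable]: "h \<in> borel_measurable borel"
  shows "(\<integral>\<^sup>+x. h (n \<bullet> x) * indicator (cball 0 1) x \<partial>lborel)
    = ennreal (unit_ball_vol (DIM('a) - 1)) *
       (\<integral>\<^sup>+t. h t * (indicator {-1..1} t * ennreal (sqrt (1 - t\<^sup>2) ^ (DIM('a) - 1))) \<partial>lborel)"
proof -
  obtain e :: 'a where e: "e \<in> Basis"
    using nonempty_Basis by blast
  define f where "f = householder (n - e)"
  have f: "orthogonal_transformation f"
    by (simp add: f_def orthogonal_transformation_householder)
  have [measurable]: "f \<in> borel_measurable borel"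
    unfolding f_def householder_def by measurable
  have [measurable]: "cball (0::'a) 1 \<in> sets borel"
    by simp
  have "f n = e"
    using n e by (simp add: f_def householder_diff)
  then have inner_f: "e \<bullet> f x = n \<bullet> x" for x
    using f by (auto simp: orthogonal_transformation_def)
  have norm_f: "norm (f x) = norm x" for x
    using f by (auto simp: orthogonal_transformation)
  have "(\<integral>\<^sup>+x. h (n \<bullet> x) * indicator (cball 0 1) x \<partial>lborel) = (\<integral>\<^sup>+x. h (e \<bullet> f x) * indicator (cball 0 1) (f x) \<partial>lborel)"
    by (intro nn_integral_cong) (simp add: inner_f norm_f indicator_def)
  also have "\<dots> = (\<integral>\<^sup>+x. h (e \<bullet> x) * indicator (cball 0 1) x \<partial>distr lborel borel f)"
    by (subst nn_integral_distr) measurable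
  finally show ?thesis
    by (simp only: distr_lborel_orthogonal_transformation[OF f] nn_integral_cball_inner_Basis[OF e assms(2)])
qed

lemma nn_integral_abs_sqrt_power:
  "(\<integral>\<^sup>+t. ennreal \<bar>t\<bar> * (indicator {-1..1} t * ennreal (sqrt (1 - t\<^sup>2) ^ k)) \<partial>lborel) = ennreal (2 / (real k + 2))"
proof -
  let ?f = "\<lambda>t::real. t * sqrt (1 - t\<^sup>2) ^ k"
  let ?I = "\<integral>\<^sup>+t. ennreal (?f t) * indicator {0..1} t \<partial>lborel"
  \<comment> \<open>An antiderivative of \<open>?f\<close>. The chain rule through the square root
    breaks down at t = 1, hence the version of the fundamental theorem that differentiates only in
    the interior.\<close>
  define F where "F = (\<lambda>t::real. - (sqrt (1 - t\<^sup>2) ^ (k + 2) / (real k + 2)))"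
  have "(?f has_integral F 1 - F 0) {0..1}"
  proof (rule fundamental_theorem_of_calculus_interior)
    show "continuous_on {0..1} F"
      unfolding F_def by (intro continuous_intros) auto
    show "(F has_vector_derivative ?f t) (at t)" if "t \<in> {0<..<1}" for t
    proof -
      have t: "1 - t\<^sup>2 > 0"
        using that by (simp add: abs_square_less_1)
      then have "((\<lambda>t. sqrt (1 - t\<^sup>2)) has_real_derivative - t / sqrt (1 - t\<^sup>2)) (at t)"
        by (auto intro!: derivative_eq_intros simp: field_simps)
      from DERIV_power[OF this, of "k + 2"]
      have "(F has_real_derivative - (real (k + 2) * (- t / sqrt (1 - t\<^sup>2) * sqrt (1 - t\<^sup>2) ^ (k + 1)) / (real k + 2))) (at t)"
        unfolding F_def by (intro DERIV_minus DERIV_cdivide) (simp add: mult_ac)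
      also have "- (real (k + 2) * (- t / sqrt (1 - t\<^sup>2) * sqrt (1 - t\<^sup>2) ^ (k + 1)) / (real k + 2)) = ?f t"
        using t by (simp add: field_simps)
      finally show ?thesis
        by (simp add: has_real_derivative_iff_has_vector_derivative)
    qed
  qed simp
  moreover have "F 1 - F 0 = 1 / (real k + 2)"
    by (simp add: F_def)
  ultimately have I: "?I = ennreal (1 / (real k + 2))"
    by (intro nn_integral_has_integral_lebesgue') (auto simp: abs_square_le_1)
  \<comment> \<open>The integrand is even. Both indicators on the right hold at t = 0, but the
    integrand vanishes there, so nothing is counted twice.\<close>
  have "(\<integral>\<^sup>+t. ennreal \<bar>t\<bar> * (indicator {-1..1} t * ennreal (sqrt (1 - t\<^sup>2) ^ k)) \<partial>lborel)
    = (\<integral>\<^sup>+t. ennreal (?f t) * indicator {0..1} t + ennreal (?f (-t)) * indicator {0..1} (-t) \<partial>lborel)"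
    by (intro nn_integral_cong) (auto simp: indicator_def abs_if simp flip: ennreal_mult')
  also have "\<dots> = ?I + (\<integral>\<^sup>+t. ennreal (?f (-t)) * indicator {0..1} (-t) \<partial>lborel)"
    by (rule nn_integral_add) measurable
  also have "(\<integral>\<^sup>+t. ennreal (?f (-t)) * indicator {0..1} (-t) \<partial>lborel) = ?I"
    by (subst (2) nn_integral_real_affine[where c="-1" and t=0]) simp_all
  finally show ?thesis
    by (simp add: I flip: ennreal_plus)
qed

text \<open>With c the volume of the (d-1)-dimensional unit ball, the slab has volume at most 2 w c,
  since the weight sqrt (1 - t^2) ^ (d - 1) is at most 1. The first moment equals 2 c / (d + 1)
  exactly. The factor (d + 1) w is the quotient.\<close>

lemma emeasure_slab_le_first_moment:
  fixes n :: "'a::euclidean_space"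
  assumes n: "norm n = 1" and w: "0 \<le> w"
  shows "emeasure lborel {x \<in> cball 0 1. \<bar>n \<bullet> x\<bar> \<le> w}
    \<le> ennreal ((real DIM('a) + 1) * w) * (\<integral>\<^sup>+x. ennreal \<bar>n \<bullet> x\<bar> * indicator (cball 0 1) x \<partial>lborel)"
proof -
  define d where "d = real DIM('a)"
  define c where "c = ennreal (unit_ball_vol (DIM('a) - 1))"
  have d: "real (DIM('a) - 1) + 2 = d + 1" "d \<ge> 1"
    by (simp_all add: d_def of_nat_diff Suc_leI)
  have "emeasure lborel {x \<in> cball 0 1. \<bar>n \<bullet> x\<bar> \<le> w} = (\<integral>\<^sup>+x. indicator {x \<in> cball 0 1. \<bar>n \<bullet> x\<bar> \<le> w} x \<partial>lborel)"
    by (rule nn_integral_indicator[symmetric]) simp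
  also have "\<dots> = (\<integral>\<^sup>+x. indicator {-w..w} (n \<bullet> x) * indicator (cball 0 1) x \<partial>lborel)"
    by (intro nn_integral_cong) (auto simp: indicator_def)
  also have "\<dots> = c * (\<integral>\<^sup>+t. indicator {-w..w} t * (indicator {-1..1} t * ennreal (sqrt (1 - t\<^sup>2) ^ (DIM('a) - 1))) \<partial>lborel)"
    unfolding c_def by (rule nn_integral_cball_inner[OF n]) measurable
  also have "\<dots> \<le> c * (\<integral>\<^sup>+t. indicator {-w..w} t \<partial>lborel)"
    by (intro mult_left_mono nn_integral_mono) (auto simp: indicator_def power_le_one abs_square_le_1)
  also have "\<dots> = c * ennreal (2 * w)"
    using w by simp
  also have "2 * w = (d + 1) * w * (2 / (d + 1))"
    using d by simp
  also have "c * ennreal \<dots> = ennreal ((d + 1) * w) * (c * ennreal (2 / (d + 1)))"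
    using d w by (subst ennreal_mult) (simp_all add: mult_ac)
  also have "c * ennreal (2 / (d + 1)) = (\<integral>\<^sup>+x. ennreal \<bar>n \<bullet> x\<bar> * indicator (cball 0 1) x \<partial>lborel)"
    unfolding c_def d(1)[symmetric] nn_integral_abs_sqrt_power[symmetric]
    by (rule nn_integral_cball_inner[OF n, symmetric]) measurable
  finally show ?thesis
    by (simp add: d_def)
qed

subsection \<open>The uniform distribution on the sphere\<close>

lemma space_unif_sphere [simp]: "space unif_sphere = sphere 0 1"
  by (simp add: unif_sphere_def space_restrict_space)

lemma measurable_unif_sphere: "f \<in> borel \<rightarrow>\<^sub>M M \<Longrightarrow> f \<in> unif_sphere \<rightarrow>\<^sub>M M"
  unfolding unif_sphere_def by (rule measurable_restrict_space1) simp

lemma emeasure_unit_ball: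
  "emeasure lborel (ball (0::'a::euclidean_space) 1) \<noteq> 0" "emeasure lborel (ball (0::'a) 1) \<noteq> \<top>"
  using unit_ball_vol_pos[of "DIM('a)"] by (simp_all add: emeasure_ball less_le)

lemma AE_uniform_unit_ball_nonzero: "AE x in uniform_measure lborel (ball (0::'a::euclidean_space) 1). x \<noteq> 0"
  using AE_lborel_singleton[of "0::'a"] emeasure_unit_ball[where 'a='a]
  by (subst AE_uniform_measure) (auto simp: less_top)

lemma nn_integral_unif_sphere:
  fixes f :: "'a::euclidean_space \<Rightarrow> ennreal"
  assumes [measurable]: "f \<in> borel_measurable borel"
  shows "(\<integral>\<^sup>+u. f u \<partial>unif_sphere)
    = (\<integral>\<^sup>+x. f (x /\<^sub>R norm x) * indicator (ball 0 1) x \<partial>lborel) / emeasure lborel (ball (0::'a) 1)"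
proof -
  have [measurable]: "sphere (0::'a) 1 \<in> sets borel" "ball (0::'a) 1 \<in> sets borel"
    by simp_all
  let ?P = "uniform_measure lborel (ball (0::'a) 1)"
  have "(\<integral>\<^sup>+u. f u \<partial>unif_sphere) = (\<integral>\<^sup>+u. f u * indicator (sphere 0 1) u \<partial>distr ?P borel (\<lambda>x. x /\<^sub>R norm x))"
    unfolding unif_sphere_def by (rule nn_integral_restrict_space) simp
  also have "\<dots> = (\<integral>\<^sup>+x. f (x /\<^sub>R norm x) * indicator (sphere 0 1) (x /\<^sub>R norm x) \<partial>?P)"
    by (rule nn_integral_distr) measurable
  \<comment> \<open>The origin is the only point that the projection does not send to the sphere (it
    goes to 0), and it is a null set.\<close>
  also have "\<dots> = (\<integral>\<^sup>+x. f (x /\<^sub>R norm x) \<partial>?P)"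
    by (intro nn_integral_cong_AE eventually_mono[OF AE_uniform_unit_ball_nonzero]) (simp add: indicator_def)
  also have "\<dots> = (\<integral>\<^sup>+x. f (x /\<^sub>R norm x) * indicator (ball 0 1) x \<partial>lborel) / emeasure lborel (ball (0::'a) 1)"
    by (rule nn_integral_uniform_measure) measurable
  finally show ?thesis .
qed

lemma prob_space_unif_sphere: "prob_space (unif_sphere :: 'a::euclidean_space measure)"
proof
  have "emeasure unif_sphere (space unif_sphere :: 'a set) = (\<integral>\<^sup>+u. 1 \<partial>(unif_sphere :: 'a measure))"
    by simp
  also have "\<dots> = 1"
    using emeasure_unit_ball[where 'a='a] by (subst nn_integral_unif_sphere) (auto simp: less_top intro: ennreal_divide_self)
  finally show "emeasure unif_sphere (space unif_sphere :: 'a set) = 1" .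
qed

text \<open>A linear isometry commutes with x / norm x and preserves the ball, so the invariance of
  Lebesgue measure passes to its radial projection.\<close>

lemma integral_unif_sphere_orthogonal_transformation:
  fixes f :: "'a::euclidean_space \<Rightarrow> 'a" and g :: "'a \<Rightarrow> real"
  assumes f: "orthogonal_transformation f" and [measurable]: "g \<in> borel_measurable borel"
  shows "(\<integral>u. g (f u) \<partial>unif_sphere) = (\<integral>u. g u \<partial>unif_sphere)"
proof -
  have lin: "linear f" and norm_f: "\<And>x. norm (f x) = norm x"
    using f by (auto simp: orthogonal_transformation)
  have [measurable]: "f \<in> borel_measurable borel"
    using lin by (intro borel_measurable_continuous_onI linear_continuous_on linear_conv_bounded_linear[THEN iffD1])
  have meas: "f \<in> borel_measurable unif_sphere" "(\<lambda>u::'a. u) \<in> borel_measurable unif_sphere"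
    by (rule measurable_unif_sphere, measurable)+
  have "distr unif_sphere borel f = distr unif_sphere borel (\<lambda>u. u)"
  proof (rule measure_eqI)
    fix A assume "A \<in> sets (distr unif_sphere borel f)"
    then have [measurable]: "A \<in> sets borel" "ball (0::'a) 1 \<in> sets borel" by simp_all
    have em: "emeasure (distr unif_sphere borel h) A = (\<integral>\<^sup>+u. indicator A (h u) \<partial>unif_sphere)"
      if [measurable]: "h \<in> borel_measurable unif_sphere" for h :: "'a \<Rightarrow> 'a"
      by (subst nn_integral_indicator[symmetric], simp, subst nn_integral_distr) simp_all
    let ?h = "\<lambda>x::'a. indicator A (x /\<^sub>R norm x) * indicator (ball 0 1) x :: ennreal"
    have "(\<integral>\<^sup>+x. indicator A (f (x /\<^sub>R norm x)) * indicator (ball 0 1) x \<partial>lborel) = (\<integral>\<^sup>+x. ?h (f x) \<partial>lborel)"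
      by (intro nn_integral_cong) (simp add: norm_f linear_cmul[OF lin] indicator_def)
    also have "\<dots> = (\<integral>\<^sup>+x. ?h x \<partial>distr lborel borel f)"
      by (rule nn_integral_distr[symmetric]) measurable
    finally have eq: "(\<integral>\<^sup>+x. indicator A (f (x /\<^sub>R norm x)) * indicator (ball 0 1) x \<partial>lborel) = (\<integral>\<^sup>+x. ?h x \<partial>lborel)"
      by (simp only: distr_lborel_orthogonal_transformation[OF f])
    show "emeasure (distr unif_sphere borel f) A = emeasure (distr unif_sphere borel (\<lambda>u. u)) A"
      by (simp add: em meas nn_integral_unif_sphere eq)
  qed simp
  then have "(\<integral>u. g u \<partial>distr unif_sphere borel f) = (\<integral>u. g u \<partial>distr unif_sphere borel (\<lambda>u. u))"
    by simp
  then show ?thesis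
    by (simp add: integral_distr meas)
qed

lemma borel_measurable_inner_unif_sphere [measurable]:
  "(\<lambda>u. n \<bullet> u) \<in> borel_measurable (unif_sphere :: 'a::euclidean_space measure)"
  by (rule measurable_unif_sphere) measurable

lemma abs_inner_sphere_le: "u \<in> sphere 0 1 \<Longrightarrow> \<bar>n \<bullet> u\<bar> \<le> norm n"
  using Cauchy_Schwarz_ineq2[of n u] by simp

lemma integrable_inner_unif_sphere:
  "integrable unif_sphere (\<lambda>u::'a::euclidean_space. n \<bullet> u)"
proof -
  interpret prob_space "unif_sphere :: 'a measure" by (rule prob_space_unif_sphere)
  show ?thesis
    by (rule integrable_const_bound[where B="norm n"]) (auto simp: abs_inner_sphere_le)
qed

text \<open>For u = x / norm x with 0 < norm x <= 1, |n . x| <= |n . u|. So the ball points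
  projecting into the slab of the sphere lie in the slab of the ball, and the first moment over the
  ball is at most that over the sphere. Both inequalities point the way needed to import the
  estimate for the ball.\<close>

lemma measure_slab_unif_sphere_le:
  fixes n :: "'a::euclidean_space"
  assumes n: "norm n = 1" and w: "0 \<le> w"
  shows "measure unif_sphere {u \<in> sphere 0 1. \<bar>n \<bullet> u\<bar> \<le> w} \<le> (real DIM('a) + 1) * w * (\<integral>u. \<bar>n \<bullet> u\<bar> \<partial>unif_sphere)"
proof -
  interpret prob_space "unif_sphere :: 'a measure" by (rule prob_space_unif_sphere)
  define K where "K = (real DIM('a) + 1) * w"
  define A where "A = (\<integral>u. \<bar>n \<bullet> u\<bar> \<partial>unif_sphere)"
  define V where "V = emeasure lborel (ball (0::'a) 1)"
  have [measurable]: "cball (0::'a) 1 \<in> sets borel" "ball (0::'a) 1 \<in> sets borel" by simp_all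
  have K: "K \<ge> 0" using w by (simp add: K_def)
  have A: "(\<integral>\<^sup>+u. ennreal \<bar>n \<bullet> u\<bar> \<partial>unif_sphere) = ennreal A"
    unfolding A_def by (rule nn_integral_eq_integral) (auto intro!: integrable_abs integrable_inner_unif_sphere)
  have "A \<ge> 0" by (simp add: A_def)
  let ?Z = "{u \<in> sphere 0 1. \<bar>n \<bullet> u\<bar> \<le> w}"
  have Z: "?Z = {u \<in> space unif_sphere. \<bar>n \<bullet> u\<bar> \<le> w}"
    by simp
  have [measurable]: "?Z \<in> sets unif_sphere"
    unfolding Z by measurable
  have "emeasure unif_sphere ?Z = (\<integral>\<^sup>+u. indicator ?Z u \<partial>unif_sphere)"
    by (rule nn_integral_indicator[symmetric]) measurable
  also have "\<dots> = (\<integral>\<^sup>+u. indicator {-w..w} (n \<bullet> u) \<partial>unif_sphere)"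
    by (intro nn_integral_cong) (auto simp: indicator_def)
  also have "\<dots> = (\<integral>\<^sup>+x. indicator {-w..w} (n \<bullet> (x /\<^sub>R norm x)) * indicator (ball 0 1) x \<partial>lborel) / V"
    unfolding V_def by (rule nn_integral_unif_sphere) measurable
  also have "\<dots> \<le> (\<integral>\<^sup>+x. indicator {x \<in> cball 0 1. \<bar>n \<bullet> x\<bar> \<le> w} x \<partial>lborel) / V"
  proof (intro divide_right_mono_ennreal nn_integral_mono)
    fix x :: 'a
    have "\<bar>n \<bullet> x\<bar> \<le> w" if "\<bar>n \<bullet> (x /\<^sub>R norm x)\<bar> \<le> w" "norm x < 1"
    proof -
      have "\<bar>n \<bullet> x\<bar> = \<bar>n \<bullet> (x /\<^sub>R norm x)\<bar> * norm x"
        by (cases "x = 0") (simp_all add: abs_mult)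
      also have "\<dots> \<le> w * 1"
        using that w by (intro mult_mono) auto
      finally show ?thesis by simp
    qed
    then show "indicator {-w..w} (n \<bullet> (x /\<^sub>R norm x)) * indicator (ball 0 1) x
      \<le> (indicator {x \<in> cball 0 1. \<bar>n \<bullet> x\<bar> \<le> w} x :: ennreal)"
      by (auto simp: indicator_def abs_le_iff)
  qed
  also have "(\<integral>\<^sup>+x. indicator {x \<in> cball 0 1. \<bar>n \<bullet> x\<bar> \<le> w} x \<partial>lborel) = emeasure lborel {x \<in> cball 0 1. \<bar>n \<bullet> x\<bar> \<le> w}"
    by (rule nn_integral_indicator) simp
  also have "\<dots> / V \<le> ennreal K * (\<integral>\<^sup>+x. ennreal \<bar>n \<bullet> x\<bar> * indicator (cball 0 1) x \<partial>lborel) / V"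
    unfolding K_def by (intro divide_right_mono_ennreal emeasure_slab_le_first_moment n w)
  \<comment> \<open>The closed and the open ball differ by the unit sphere, which is null.\<close>
  also have "(\<integral>\<^sup>+x. ennreal \<bar>n \<bullet> x\<bar> * indicator (cball 0 1) x \<partial>lborel)
    \<le> (\<integral>\<^sup>+x. ennreal \<bar>n \<bullet> (x /\<^sub>R norm x)\<bar> * indicator (ball 0 1) x \<partial>lborel)"
  proof (rule nn_integral_mono_AE)
    have "sphere (0::'a) 1 \<in> null_sets lborel"
      using negligible_sphere[of "0::'a" 1] by (auto simp: null_sets_completion_iff negligible_iff_null_sets negligible_convex_frontier)
    then have "AE x in lborel. x \<notin> sphere (0::'a) 1"
      by (rule AE_not_in)
    then show "AE x in lborel. ennreal \<bar>n \<bullet> x\<bar> * indicator (cball 0 1) x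
      \<le> ennreal \<bar>n \<bullet> (x /\<^sub>R norm x)\<bar> * indicator (ball 0 1) x"
    proof eventually_elim
      case (elim x)
      have "\<bar>n \<bullet> x\<bar> \<le> \<bar>n \<bullet> (x /\<^sub>R norm x)\<bar>" if "norm x < 1"
        using that by (cases "x = 0") (auto simp: abs_mult field_simps intro: mult_left_le_one_le)
      then show ?case
        using elim by (auto simp: indicator_def)
    qed
  qed
  also have "ennreal K * (\<integral>\<^sup>+x. ennreal \<bar>n \<bullet> (x /\<^sub>R norm x)\<bar> * indicator (ball 0 1) x \<partial>lborel) / V
    = ennreal K * (\<integral>\<^sup>+u. ennreal \<bar>n \<bullet> u\<bar> \<partial>unif_sphere)"
    unfolding V_def by (subst nn_integral_unif_sphere) (measurable, simp add: ennreal_times_divide)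
  also have "\<dots> = ennreal (K * A)"
    using K \<open>A \<ge> 0\<close> by (simp add: A ennreal_mult)
  finally have "emeasure unif_sphere ?Z \<le> ennreal (K * A)"
    by (simp add: divide_right_mono_ennreal mult_left_mono)
  then show ?thesis
    using K \<open>A \<ge> 0\<close> by (simp add: emeasure_eq_measure K_def A_def)
qed

text \<open>For w = 1 the slab is the whole sphere, so the slab estimate says that 1 is at most (d +
  1) times this mean.\<close>

lemma integral_abs_inner_unif_sphere_pos:
  fixes n :: "'a::euclidean_space"
  assumes "norm n = 1"
  shows "0 < (\<integral>u. \<bar>n \<bullet> u\<bar> \<partial>unif_sphere)"
proof -
  interpret prob_space "unif_sphere :: 'a measure" by (rule prob_space_unif_sphere)
  have "{u \<in> sphere 0 1. \<bar>n \<bullet> u\<bar> \<le> 1} = space unif_sphere"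
    using abs_inner_sphere_le[of _ n] assms by auto
  then have "1 \<le> (real DIM('a) + 1) * (\<integral>u. \<bar>n \<bullet> u\<bar> \<partial>unif_sphere)"
    using measure_slab_unif_sphere_le[OF assms, of 1] prob_space by simp
  then show ?thesis
    by (smt (verit) mult_nonneg_nonpos of_nat_0_le_iff)
qed

text \<open>Shows that in dimension 1 every u on the sphere has |n . u| = 1, so that slabs with w <
  1 are empty.\<close>

lemma abs_inner_DIM_1:
  fixes x y :: "'a::euclidean_space"
  assumes "DIM('a) = 1"
  shows "\<bar>x \<bullet> y\<bar> = norm x * norm y"
proof -
  obtain e :: 'a where e: "Basis = {e}"
    using assms by (auto simp: card_1_singleton_iff)
  have "a \<bullet> b = (a \<bullet> e) * (b \<bullet> e)" for a b :: 'a
    using euclidean_inner[of a b] unfolding e by simp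
  then show ?thesis
    by (metis norm_eq_sqrt_inner abs_mult real_sqrt_abs2)
qed

text \<open>\<open>\<psi>\<close> is arbitrary in [-1, 1] on the slab and a sign outside it. Along
  n, replacing the sign by \<open>\<psi>\<close> costs at most 2 w at each point of the slab. For
  the rest m of v, the off-slab integrand is odd under the reflection that negates m, so only the
  slab contributes.\<close>

lemma sign_average_unif_sphere:
  fixes n :: "'a::euclidean_space" and \<psi> :: "'a \<Rightarrow> real"
  assumes n: "norm n = 1"
    and [measurable]: "\<psi> \<in> borel_measurable unif_sphere"
    and bound: "\<And>u. u \<in> sphere 0 1 \<Longrightarrow> \<bar>\<psi> u\<bar> \<le> 1"
    and sgn: "\<And>u. u \<in> sphere 0 1 \<Longrightarrow> w < \<bar>n \<bullet> u\<bar> \<Longrightarrow> \<psi> u = sgn (n \<bullet> u)"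
  defines "v \<equiv> \<integral>u. \<psi> u *\<^sub>R u \<partial>unif_sphere"
    and "p \<equiv> measure unif_sphere {u \<in> sphere 0 1. \<bar>n \<bullet> u\<bar> \<le> w}"
  shows "n \<bullet> v \<ge> (\<integral>u. \<bar>n \<bullet> u\<bar> \<partial>unif_sphere) - 2 * w * p"
    and "norm (v - (n \<bullet> v) *\<^sub>R n) \<le> p"
proof -
  interpret prob_space "unif_sphere :: 'a measure" by (rule prob_space_unif_sphere)
  let ?Z = "{u \<in> sphere 0 1. \<bar>n \<bullet> u\<bar> \<le> w}"
  have Z: "?Z = {u \<in> space unif_sphere. \<bar>n \<bullet> u\<bar> \<le> w}"
    by simp
  have Z_sets: "?Z \<in> sets unif_sphere"
    unfolding Z by measurable
  have [measurable]: "(\<lambda>u::'a. u) \<in> borel_measurable unif_sphere"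
    by (rule measurable_unif_sphere) measurable
  have int_v: "integrable unif_sphere (\<lambda>u. \<psi> u *\<^sub>R u)"
    by (rule integrable_const_bound[where B=1]) (auto simp: bound)
  have int_Z: "integrable unif_sphere (\<lambda>u. c * indicat_real ?Z u)" for c
    by (intro integrable_mult_right integrable_real_indicator Z_sets) (simp add: emeasure_eq_measure)
  have inner_v: "m \<bullet> v = (\<integral>u. \<psi> u * (m \<bullet> u) \<partial>unif_sphere)" for m
    using integral_inner_right[of m unif_sphere "\<lambda>u. \<psi> u *\<^sub>R u"] int_v by (simp add: v_def)
  have int_psi: "integrable unif_sphere (\<lambda>u. \<psi> u * (m \<bullet> u))" for m
    using integrable_inner_right[OF int_v, of m] by simp
  have int_ind: "(\<integral>u. c * indicat_real ?Z u \<partial>unif_sphere) = c * p" for c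
    by (auto simp: p_def intro!: arg_cong[where f=prob])

  have "(\<integral>u. \<bar>n \<bullet> u\<bar> \<partial>unif_sphere) - 2 * w * p = (\<integral>u. \<bar>n \<bullet> u\<bar> - 2 * w * indicat_real ?Z u \<partial>unif_sphere)"
    using int_ind[of "2 * w"] int_Z[of "2 * w"]
    by (subst Bochner_Integration.integral_diff) (auto intro: integrable_inner_unif_sphere)
  also have "\<dots> \<le> (\<integral>u. \<psi> u * (n \<bullet> u) \<partial>unif_sphere)"
  proof (rule integral_mono)
    fix u :: 'a assume "u \<in> space unif_sphere"
    then have u: "u \<in> sphere 0 1" by simp
    show "\<bar>n \<bullet> u\<bar> - 2 * w * indicat_real ?Z u \<le> \<psi> u * (n \<bullet> u)"
    proof (cases "\<bar>n \<bullet> u\<bar> \<le> w")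
      case True
      \<comment> \<open>On the slab \<open>\<psi> u * (n \<bullet> u)\<close> is at least -|n . u|,
        and this is at least |n . u| - 2 w.\<close>
      have "\<bar>\<psi> u * (n \<bullet> u)\<bar> \<le> 1 * \<bar>n \<bullet> u\<bar>"
        unfolding abs_mult by (intro mult_right_mono bound u) simp
      then show ?thesis
        using True u by (simp add: indicator_def)
    next
      case False
      then have "\<psi> u * (n \<bullet> u) = \<bar>n \<bullet> u\<bar>"
        using sgn[OF u] by (simp add: abs_sgn mult.commute)
      then show ?thesis
        using False by simp
    qed
  qed (intro Bochner_Integration.integrable_diff integrable_abs integrable_inner_unif_sphere int_Z int_psi)+
  finally show "n \<bullet> v \<ge> (\<integral>u. \<bar>n \<bullet> u\<bar> \<partial>unif_sphere) - 2 * w * p"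
    by (simp add: inner_v)

  \<comment> \<open>Testing v against m itself gives m . v = |m|^2, so a scalar estimate m . v <=
    |m| p bounds the norm of m.\<close>
  define m where "m = v - (n \<bullet> v) *\<^sub>R n"
  have nn: "n \<bullet> n = 1"
    using n by (simp add: norm_eq_1)
  then have nm: "n \<bullet> m = 0"
    by (simp add: m_def inner_diff_right)
  have mv: "m \<bullet> v = (norm m)\<^sup>2"
  proof -
    have "m \<bullet> m = m \<bullet> v - (n \<bullet> v) * (n \<bullet> m)"
      by (subst (2) m_def) (simp add: inner_diff_right inner_commute)
    then show ?thesis using nm by (simp add: power2_norm_eq_inner)
  qed
  \<comment> \<open>The off-slab part of the integrand, written with the explicit sign: this makes g
    Borel on the whole space, as the invariance lemma demands, whereas \<open>\<psi>\<close> is only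
    measurable on the sphere.\<close>
  define g where "g u = (if w < \<bar>n \<bullet> u\<bar> then sgn (n \<bullet> u) * (m \<bullet> u) else 0)" for u
  have [measurable]: "g \<in> borel_measurable borel"
    unfolding g_def by measurable
  have g_meas: "g \<in> borel_measurable unif_sphere"
    by (rule measurable_unif_sphere) measurable
  have g_bound: "\<bar>g u\<bar> \<le> norm m" if "u \<in> sphere 0 1" for u
    using abs_inner_sphere_le[OF that, of m] by (auto simp: g_def abs_mult abs_sgn_eq)
  have int_g: "integrable unif_sphere g"
    by (rule integrable_const_bound[where B="norm m"]) (auto simp: g_bound g_meas)
  \<comment> \<open>The reflection in the hyperplane orthogonal to m fixes n and negates g.\<close>
  have refl: "g (householder m u) = - g u" for u
  proof (cases "m = 0")
    case False
    have "n \<bullet> householder m u = n \<bullet> u" "m \<bullet> householder m u = - (m \<bullet> u)"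
      using nm False by (simp_all add: householder_def inner_diff_right)
    then show ?thesis by (simp add: g_def)
  qed (simp add: g_def)
  have "(\<integral>u. g u \<partial>unif_sphere) = (\<integral>u. g (householder m u) \<partial>unif_sphere)"
    by (rule integral_unif_sphere_orthogonal_transformation[symmetric]) (auto simp: orthogonal_transformation_householder)
  then have g0: "(\<integral>u. g u \<partial>unif_sphere) = 0"
    by (simp add: refl)
  have "(norm m)\<^sup>2 = (\<integral>u. \<psi> u * (m \<bullet> u) - g u \<partial>unif_sphere)"
    using int_psi int_g g0 by (simp add: mv[symmetric] inner_v)
  also have "\<dots> \<le> (\<integral>u. norm m * indicat_real ?Z u \<partial>unif_sphere)"
  proof (rule integral_mono)
    fix u :: 'a assume "u \<in> space unif_sphere"
    then have u: "u \<in> sphere 0 1" by simp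
    show "\<psi> u * (m \<bullet> u) - g u \<le> norm m * indicat_real ?Z u"
    proof (cases "\<bar>n \<bullet> u\<bar> \<le> w")
      case True
      have "\<bar>\<psi> u * (m \<bullet> u)\<bar> \<le> 1 * norm m"
        unfolding abs_mult by (intro mult_mono bound u abs_inner_sphere_le) auto
      then show ?thesis
        using True u by (simp add: indicator_def g_def)
    next
      case False
      then show ?thesis
        using sgn[OF u] by (simp add: g_def)
    qed
  qed (intro Bochner_Integration.integrable_diff int_g int_Z int_psi)+
  also have "\<dots> = norm m * p"
    by (rule int_ind)
  finally have "norm m * norm m \<le> norm m * p"
    by (simp add: power2_eq_square)
  moreover have "p \<ge> 0"
    by (simp add: p_def)
  ultimately show "norm (v - (n \<bullet> v) *\<^sub>R n) \<le> p"
    unfolding m_def[symmetric] by (cases "norm m = 0") (auto simp: mult_le_cancel_left)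
qed

text \<open>Every coordinate of the product measure has law \<open>unif_sphere\<close>, so the B
  summands share one expectation and their average equals it.\<close>

lemma expected_grad_est_eq:
  fixes xt :: "'a::euclidean_space"
  assumes B: "B \<ge> 1"
    and [measurable]: "(\<lambda>u. sign_phi S (xt + \<delta> *\<^sub>R u)) \<in> borel_measurable unif_sphere"
  shows "expected_grad_est S xt \<delta> B = (\<integral>u. sign_phi S (xt + \<delta> *\<^sub>R u) *\<^sub>R u \<partial>unif_sphere)"
proof -
  interpret prob_space "unif_sphere :: 'a measure" by (rule prob_space_unif_sphere)
  let ?M = "PiM {..<B} (\<lambda>_. unif_sphere :: 'a measure)"
  define h where "h u = sign_phi S (xt + \<delta> *\<^sub>R u) *\<^sub>R u" for u
  have [measurable]: "(\<lambda>u::'a. u) \<in> borel_measurable unif_sphere"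
    by (rule measurable_unif_sphere) measurable
  have [measurable]: "h \<in> borel_measurable unif_sphere"
    unfolding h_def by measurable
  have int_h: "integrable unif_sphere h"
    by (rule integrable_const_bound[where B=1]) (auto simp: h_def sign_phi_def)
  have D: "distr ?M unif_sphere (\<lambda>\<omega>. \<omega> b) = unif_sphere" if "b < B" for b
    using that by (intro distr_PiM_component) (auto simp: prob_space_unif_sphere)
  have comp: "integrable ?M (\<lambda>us. h (us b))" "(\<integral>us. h (us b) \<partial>?M) = (\<integral>u. h u \<partial>unif_sphere)" if b: "b < B" for b
  proof -
    have [measurable]: "(\<lambda>\<omega>. \<omega> b) \<in> ?M \<rightarrow>\<^sub>M unif_sphere"
      using b by (intro measurable_component_singleton) simp
    show "integrable ?M (\<lambda>us. h (us b))"
      using int_h by (subst (asm) D[OF b, symmetric], subst (asm) integrable_distr_eq) auto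
    show "(\<integral>us. h (us b) \<partial>?M) = (\<integral>u. h u \<partial>unif_sphere)"
      by (subst (2) D[OF b, symmetric], subst integral_distr) auto
  qed
  have "expected_grad_est S xt \<delta> B = (1 / real B) *\<^sub>R (\<Sum>b<B. \<integral>us. h (us b) \<partial>?M)"
    unfolding expected_grad_est_def h_def[symmetric]
    by (simp add: comp Bochner_Integration.integral_sum)
  also have "\<dots> = (\<integral>u. h u \<partial>unif_sphere)"
    using B by (simp add: comp sum_constant_scaleR)
  finally show ?thesis
    by (simp add: h_def)
qed

subsection \<open>The cosine bound\<close>

text \<open>Along the ray, S minus its linear part has a derivative of size at most L s. Adding or
  subtracting L s^2 / 2 therefore makes it monotone, and comparing s = 0 with s =
  \<open>\<delta>\<close> gives the remainder.\<close>

lemma abs_diff_le_of_Lipschitz_gradient: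
  fixes S :: "'a::euclidean_space \<Rightarrow> real"
  assumes grad: "\<And>x. x \<in> U \<Longrightarrow> GDERIV S x :> gradS x"
    and lip: "\<And>x y. x \<in> U \<Longrightarrow> y \<in> U \<Longrightarrow> norm (gradS x - gradS y) \<le> L * norm (x - y)"
    and U: "cball xt \<delta> \<subseteq> U" and \<delta>: "0 \<le> \<delta>" and u: "norm u = 1"
  shows "\<bar>S (xt + \<delta> *\<^sub>R u) - S xt - \<delta> * (u \<bullet> gradS xt)\<bar> \<le> L * \<delta>\<^sup>2 / 2"
proof -
  define F where "F s = S (xt + s *\<^sub>R u) - s * (u \<bullet> gradS xt)" for s
  let ?D = "\<lambda>s. u \<bullet> (gradS (xt + s *\<^sub>R u) - gradS xt)"
  have in_U: "xt + s *\<^sub>R u \<in> U" if "0 \<le> s" "s \<le> \<delta>" for s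
    using that u U by (auto simp: dist_norm subset_iff)
  have F: "(F has_real_derivative ?D s) (at s)" if s: "0 \<le> s" "s \<le> \<delta>" for s
  proof -
    have "(S has_derivative (\<lambda>h. h \<bullet> gradS (xt + s *\<^sub>R u))) (at (xt + s *\<^sub>R u))"
      using grad[OF in_U[OF s]] by (simp add: gderiv_def)
    moreover have "((\<lambda>s. xt + s *\<^sub>R u) has_derivative (\<lambda>h. h *\<^sub>R u)) (at s)"
      by (auto intro!: derivative_eq_intros)
    ultimately have "((\<lambda>s. S (xt + s *\<^sub>R u)) has_derivative (\<lambda>h. (h *\<^sub>R u) \<bullet> gradS (xt + s *\<^sub>R u))) (at s)"
      by (rule has_derivative_compose[rotated])
    then have "((\<lambda>s. S (xt + s *\<^sub>R u)) has_real_derivative (u \<bullet> gradS (xt + s *\<^sub>R u))) (at s)"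
      by (simp add: has_field_derivative_def mult_commute_abs)
    then show ?thesis
      unfolding F_def by (auto intro!: derivative_eq_intros simp: inner_diff_right)
  qed
  have D: "\<bar>?D s\<bar> \<le> L * s" if s: "0 \<le> s" "s \<le> \<delta>" for s
  proof -
    have "\<bar>?D s\<bar> \<le> norm u * norm (gradS (xt + s *\<^sub>R u) - gradS xt)"
      by (rule Cauchy_Schwarz_ineq2)
    also have "\<dots> \<le> L * s"
      using lip[OF in_U[OF s] in_U[of 0]] s \<delta> u by simp
    finally show ?thesis .
  qed
  have "F 0 + L * 0\<^sup>2 / 2 \<le> F \<delta> + L * \<delta>\<^sup>2 / 2"
  proof (rule DERIV_nonneg_imp_nondecreasing[OF \<delta>])
    fix s assume s: "0 \<le> s" "s \<le> \<delta>"
    then show "\<exists>y. ((\<lambda>s. F s + L * s\<^sup>2 / 2) has_real_derivative y) (at s) \<and> 0 \<le> y"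
      using D[OF s] by (intro exI[of _ "?D s + L * s"]) (auto intro!: derivative_eq_intros F)
  qed
  moreover have "F \<delta> - L * \<delta>\<^sup>2 / 2 \<le> F 0 - L * 0\<^sup>2 / 2"
  proof (rule DERIV_nonpos_imp_nonincreasing[OF \<delta>])
    fix s assume s: "0 \<le> s" "s \<le> \<delta>"
    then show "\<exists>y. ((\<lambda>s. F s - L * s\<^sup>2 / 2) has_real_derivative y) (at s) \<and> y \<le> 0"
      using D[OF s] by (intro exI[of _ "?D s - L * s"]) (auto intro!: derivative_eq_intros F)
  qed
  ultimately have "\<bar>F \<delta> - F 0\<bar> \<le> L * \<delta>\<^sup>2 / 2"
    unfolding abs_le_iff by auto
  then show ?thesis
    by (simp add: F_def algebra_simps)
qed

section \<open>Scalar inequalities behind the constant\<close>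

lemma cos_ge_of_tan_le:
  fixes a b :: real
  assumes "0 < a"
  shows "1 - b\<^sup>2 / (2 * a\<^sup>2) \<le> a / sqrt (a\<^sup>2 + b\<^sup>2)"
proof -
  \<comment> \<open>Half the squared tangent. The cosine is 1 / sqrt (1 + 2 y), and sqrt (1 + 2 y)
    <= 1 + y while 1 / (1 + y) >= 1 - y.\<close>
  define y where "y = b\<^sup>2 / (2 * a\<^sup>2)"
  have y: "y \<ge> 0" "b\<^sup>2 = 2 * a\<^sup>2 * y"
    using assms by (simp_all add: y_def)
  have "sqrt (a\<^sup>2 + b\<^sup>2) \<le> a * (1 + y)"
  proof (rule real_le_lsqrt)
    have "(a * (1 + y))\<^sup>2 = a\<^sup>2 + b\<^sup>2 + (a * y)\<^sup>2"
      by (simp only: y(2)) (simp add: power2_eq_square algebra_simps)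
    then show "a\<^sup>2 + b\<^sup>2 \<le> (a * (1 + y))\<^sup>2"
      by simp
  qed (use assms y in auto)
  then have "a / (a * (1 + y)) \<le> a / sqrt (a\<^sup>2 + b\<^sup>2)"
    using assms y by (intro divide_left_mono) (auto intro!: mult_pos_pos add_pos_nonneg)
  moreover have "a / (a * (1 + y)) = 1 / (1 + y)"
    using assms by simp
  moreover have "1 - y \<le> 1 / (1 + y)"
  proof -
    have "(1 - y) * (1 + y) \<le> 1"
      by (simp add: algebra_simps)
    then show ?thesis
      using y by (subst pos_le_divide_eq) auto
  qed
  ultimately show ?thesis
    by (simp add: y_def)
qed

lemma cos_ge_of_slab_bounds:
  fixes a b w A p :: real and d :: nat
  assumes A: "0 < A" and w: "0 \<le> w" and p: "0 \<le> p" "p \<le> (real d + 1) * w * A"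
    and a: "A - 2 * w * p \<le> a" and b: "0 \<le> b" "b \<le> p"
    and d: "d \<ge> 1" "d = 1 \<Longrightarrow> p = 0" and small: "real d * w < 2 / 3"
  shows "1 - 9 / 2 * (real d * w)\<^sup>2 \<le> a / sqrt (a\<^sup>2 + b\<^sup>2)"
proof -
  define x where "x = real d * w"
  have x: "0 \<le> x" "x < 2 / 3"
    using w small by (auto simp: x_def)
  have px: "p \<le> 3 / 2 * x * A" and wp: "2 * w * p \<le> 3 / 2 * x\<^sup>2 * A"
  proof -
    have "p \<le> 3 / 2 * x * A \<and> 2 * w * p \<le> 3 / 2 * x\<^sup>2 * A"
    proof (cases "d = 1")
      case True
      then show ?thesis using d x A by simp
    next
      case False
      \<comment> \<open>From d >= 2 come both d + 1 <= 3/2 d, the source of the factor 3/2, and 2 w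
        <= x.\<close>
      then have d2: "real d \<ge> 2" using d by simp
      have "p \<le> (real d + 1) * (w * A)"
        using p by (simp only: mult.assoc)
      also have "\<dots> \<le> (3 / 2 * real d) * (w * A)"
        using d2 w A by (intro mult_right_mono) auto
      finally have p': "p \<le> 3 / 2 * x * A"
        by (simp add: x_def mult_ac)
      have "2 * w \<le> x"
        using d2 w by (simp add: x_def mult_right_mono)
      then have "(2 * w) * p \<le> x * (3 / 2 * x * A)"
        using p p' w x by (intro mult_mono) auto
      then show ?thesis
        using p' by (simp add: power2_eq_square mult_ac)
    qed
    then show "p \<le> 3 / 2 * x * A" "2 * w * p \<le> 3 / 2 * x\<^sup>2 * A" by auto
  qed
  have a1: "A * (1 - 3 / 2 * x\<^sup>2) \<le> a"
    using a wp by (simp add: algebra_simps)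
  have "x\<^sup>2 \<le> (2 / 3)\<^sup>2"
    using x by (intro power_mono) auto
  then have "0 < A * (1 - 3 / 2 * x\<^sup>2)"
    using A by (intro mult_pos_pos) (auto simp: power2_eq_square)
  with a1 have a0: "0 < a" by simp
  show ?thesis
  \<comment> \<open>In the first case the claimed bound is at most 0 and the positivity of a
    suffices. In the second, 3/2 x^2 < 1/3, which gives the factor 2/3 between A and a.\<close>
  proof (cases "9 / 2 * x\<^sup>2 \<ge> 1")
    case True
    then show ?thesis
      using a0 by (simp add: x_def[symmetric] order_trans[of _ 0])
  next
    case False
    have "A * (2 / 3) \<le> A * (1 - 3 / 2 * x\<^sup>2)"
      using False A by (intro mult_left_mono) auto
    also note a1
    finally have "A \<le> 3 / 2 * a"
      by simp
    then have "3 / 2 * x * A \<le> 3 / 2 * x * (3 / 2 * a)"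
      using x by (intro mult_left_mono) auto
    with order_trans[OF b(2) px] have "b \<le> 3 / 2 * x * (3 / 2 * a)"
      by (rule order_trans)
    then have "b \<le> 9 / 4 * x * a"
      by simp
    then have "b\<^sup>2 \<le> (9 / 4 * x * a)\<^sup>2"
      using b by (intro power_mono) auto
    also have "\<dots> = 81 / 16 * (x\<^sup>2 * a\<^sup>2)"
      by (simp add: power2_eq_square)
    also have "\<dots> \<le> 9 * (x\<^sup>2 * a\<^sup>2)"
      by (intro mult_right_mono) auto
    finally have "b\<^sup>2 / (2 * a\<^sup>2) \<le> 9 / 2 * x\<^sup>2"
      using a0 by (simp add: field_simps)
    then show ?thesis
      using cos_ge_of_tan_le[OF a0, of b] by (simp add: x_def)
  qed
qed

text \<open>If a or b is 0 the quotient is 0, so the bounds hold for all vectors. They can thus be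
  used where the expectation is not known to be nonzero.\<close>

lemma cos_angle_le_1: "cos_angle a b \<le> 1" and cos_angle_ge_minus_1: "- 1 \<le> cos_angle a b"
  using Cauchy_Schwarz_ineq2[of a b]
  by (cases "a = 0 \<or> b = 0"; auto simp: cos_angle_def field_simps abs_le_iff)+

lemma cos_angle_scaleR_right:
  assumes "0 < c"
  shows "cos_angle v (c *\<^sub>R n) = cos_angle v n"
  using assms by (simp add: cos_angle_def)

lemma cos_expected_grad_est_ge:
  fixes S :: "'a::euclidean_space \<Rightarrow> real"
  assumes grad: "\<And>x. x \<in> U \<Longrightarrow> GDERIV S x :> gradS x"
    and lip: "\<And>x y. x \<in> U \<Longrightarrow> y \<in> U \<Longrightarrow> norm (gradS x - gradS y) \<le> L * norm (x - y)"
    and S0: "S xt = 0" and g0: "gradS xt \<noteq> 0" and B: "B \<ge> 1"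
    and \<delta>: "0 < \<delta>" and U: "cball xt \<delta> \<subseteq> U"
  shows "1 - 9 * L\<^sup>2 * \<delta>\<^sup>2 * (real DIM('a))\<^sup>2 / (8 * (norm (gradS xt))\<^sup>2)
    \<le> cos_angle (expected_grad_est S xt \<delta> B) (gradS xt)"
proof -
  define N where "N = norm (gradS xt)"
  define n where "n = gradS xt /\<^sub>R N"
  \<comment> \<open>The threshold at which the linear term
    \<open>\<delta> * N * \<bar>n \<bullet> u\<bar>\<close> equals the Taylor remainder L
    \<open>\<delta>\<close>^2 / 2.\<close>
  define w where "w = L * \<delta> / (2 * N)"
  define \<psi> where "\<psi> u = sign_phi S (xt + \<delta> *\<^sub>R u)" for u
  define v where "v = (\<integral>u. \<psi> u *\<^sub>R u \<partial>unif_sphere)"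
  define p where "p = measure unif_sphere {u \<in> sphere 0 1. \<bar>n \<bullet> u\<bar> \<le> w}"
  define A where "A = (\<integral>u. \<bar>n \<bullet> u\<bar> \<partial>unif_sphere)"
  have N: "0 < N" and n: "norm n = 1" and g: "gradS xt = N *\<^sub>R n"
    using g0 by (simp_all add: N_def n_def)
  \<comment> \<open>The sign of L is not assumed. The Lipschitz inequality at two points of U at
    distance \<open>\<delta>\<close> forces L \<open>\<delta>\<close> >= 0.\<close>
  obtain e :: 'a where "e \<in> Basis" using nonempty_Basis by blast
  then have "xt + \<delta> *\<^sub>R e \<in> U" "xt \<in> U"
    using U \<delta> by (auto simp: subset_iff dist_norm)
  from lip[OF this] have "0 \<le> L * \<delta>"
    using \<open>e \<in> Basis\<close> \<delta> order_trans[OF norm_ge_zero] by fastforce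
  then have w: "0 \<le> w"
    using N by (simp add: w_def)
  have in_U: "xt + \<delta> *\<^sub>R u \<in> U" if "u \<in> sphere 0 1" for u
    using that U \<delta> by (auto simp: dist_norm subset_iff)
  \<comment> \<open>S is controlled only on U and need not be Borel globally, so measurability is
    derived from continuity on the sphere alone.\<close>
  have "continuous_on U S"
    using grad by (auto simp: gderiv_def intro!: continuous_at_imp_continuous_on has_derivative_continuous)
  then have "continuous_on (sphere 0 1) (\<lambda>u. S (xt + \<delta> *\<^sub>R u))"
    by (rule continuous_on_compose2) (auto intro!: continuous_intros in_U)
  then have "(\<lambda>u. S (xt + \<delta> *\<^sub>R u)) \<in> borel_measurable (restrict_space borel (sphere 0 1))"
    by (rule borel_measurable_continuous_on_restrict)
  also have "borel_measurable (restrict_space borel (sphere 0 1)) = borel_measurable unif_sphere"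
    unfolding unif_sphere_def by (intro measurable_cong_sets sets_restrict_space_cong) auto
  finally have [measurable]: "(\<lambda>u. S (xt + \<delta> *\<^sub>R u)) \<in> borel_measurable unif_sphere" .
  have \<psi>_meas: "\<psi> \<in> borel_measurable unif_sphere"
    unfolding \<psi>_def sign_phi_def by measurable
  have \<psi>_bound: "\<bar>\<psi> u\<bar> \<le> 1" for u
    by (simp add: \<psi>_def sign_phi_def)
  have \<psi>_sgn: "\<psi> u = sgn (n \<bullet> u)" if u: "u \<in> sphere 0 1" and wu: "w < \<bar>n \<bullet> u\<bar>" for u
  proof -
    have S: "\<bar>S (xt + \<delta> *\<^sub>R u) - \<delta> * N * (n \<bullet> u)\<bar> \<le> L * \<delta>\<^sup>2 / 2"
      using abs_diff_le_of_Lipschitz_gradient[OF grad lip U, of u] u \<delta> S0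
      by (simp add: g inner_commute mult_ac)
    have "L * \<delta>\<^sup>2 / 2 = \<delta> * N * w"
      using N by (simp add: w_def power2_eq_square)
    also have "\<dots> < \<delta> * N * \<bar>n \<bullet> u\<bar>"
      using wu \<delta> N by simp
    \<comment> \<open>A remainder strictly smaller than the linear term leaves S nonzero with the
      sign of n . u.\<close>
    finally have "\<bar>S (xt + \<delta> *\<^sub>R u) - \<delta> * N * (n \<bullet> u)\<bar> < \<bar>\<delta> * N * (n \<bullet> u)\<bar>"
      using S \<delta> N by (simp add: abs_mult)
    moreover have "0 < \<delta> * N * (n \<bullet> u) \<longleftrightarrow> 0 < n \<bullet> u" "\<delta> * N * (n \<bullet> u) < 0 \<longleftrightarrow> n \<bullet> u < 0"
      using \<delta> N by (simp_all add: zero_less_mult_iff mult_less_0_iff)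
    moreover have "n \<bullet> u \<noteq> 0"
      using wu w by auto
    ultimately show ?thesis
      by (auto simp: \<psi>_def sign_phi_def sgn_if)
  qed
  have est: "expected_grad_est S xt \<delta> B = v"
    unfolding v_def \<psi>_def by (rule expected_grad_est_eq[OF B]) (use \<psi>_meas in \<open>simp add: \<psi>_def[abs_def]\<close>)
  note avg = sign_average_unif_sphere[OF n \<psi>_meas \<psi>_bound \<psi>_sgn, folded v_def p_def A_def]
  let ?a = "n \<bullet> v" and ?b = "norm (v - (n \<bullet> v) *\<^sub>R n)"
  have "cos_angle v (gradS xt) = ?a / norm v"
    using N n by (simp add: g cos_angle_scaleR_right) (simp add: cos_angle_def inner_commute)
  also have "norm v = sqrt (?a\<^sup>2 + ?b\<^sup>2)"
  proof -
    have "n \<bullet> n = 1" using n by (simp add: norm_eq_1)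
    then have "?b\<^sup>2 = v \<bullet> v - ?a\<^sup>2"
      by (simp only: power2_norm_eq_inner) (simp add: inner_diff_left inner_diff_right inner_commute power2_eq_square)
    then have "v \<bullet> v = ?a\<^sup>2 + ?b\<^sup>2"
      by simp
    then show ?thesis
      by (intro trans[OF norm_eq_sqrt_inner]) (rule arg_cong)
  qed
  finally have cos: "cos_angle v (gradS xt) = ?a / sqrt (?a\<^sup>2 + ?b\<^sup>2)" .
  \<comment> \<open>Since w carries the factor 1/2, the constant 9/8 becomes 9/2 in terms of d
    w.\<close>
  have K: "9 * L\<^sup>2 * \<delta>\<^sup>2 * (real DIM('a))\<^sup>2 / (8 * (norm (gradS xt))\<^sup>2) = 9 / 2 * (real DIM('a) * w)\<^sup>2"
    using N by (simp add: w_def N_def[symmetric] power2_eq_square field_simps)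
  show ?thesis
    unfolding K est
  \<comment> \<open>The value 2/3 is where 9/2 (d w)^2 reaches 2. Below it, w < 1 holds in dimension
    1, which is what empties the slab there.\<close>
  proof (cases "real DIM('a) * w < 2 / 3")
    case True
    have p1: "p = 0" if "DIM('a) = 1"
    proof -
      have "w < 1" using True that by simp
      then have "{u \<in> sphere 0 1. \<bar>n \<bullet> u\<bar> \<le> w} = {}"
        using abs_inner_DIM_1[OF that, of n] n by auto
      then show ?thesis unfolding p_def by (simp only: measure_empty)
    qed
    show "1 - 9 / 2 * (real DIM('a) * w)\<^sup>2 \<le> cos_angle v (gradS xt)"
      unfolding cos
    proof (rule cos_ge_of_slab_bounds[of A w p])
      show "0 < A"
        unfolding A_def by (rule integral_abs_inner_unif_sphere_pos[OF n])
      show "p \<le> (real DIM('a) + 1) * w * A"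
        unfolding p_def A_def by (rule measure_slab_unif_sphere_le[OF n w])
    qed (use w avg p1 True in \<open>auto simp: p_def Suc_leI\<close>)
  next
    \<comment> \<open>Here the claimed lower bound is at most -1.\<close>
    case False
    then have "(2 / 3)\<^sup>2 \<le> (real DIM('a) * w)\<^sup>2"
      by (intro power_mono) auto
    then have "1 - 9 / 2 * (real DIM('a) * w)\<^sup>2 \<le> - 1"
      by (simp add: power2_eq_square)
    then show "1 - 9 / 2 * (real DIM('a) * w)\<^sup>2 \<le> cos_angle v (gradS xt)"
      using cos_angle_ge_minus_1[of v "gradS xt"] by simp
  qed
qed

theorem theorem2:
  fixes S :: "'a::euclidean_space \<Rightarrow> real"
    and gradS :: "'a \<Rightarrow> 'a"
    and U :: "'a set"
    and xt :: 'a
    and L :: real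
    and B :: nat
  assumes "open U" and "xt \<in> U"
    and "\<And>x. x \<in> U \<Longrightarrow> GDERIV S x :> gradS x"
    and "\<And>x y. x \<in> U \<Longrightarrow> y \<in> U \<Longrightarrow> norm (gradS x - gradS y) \<le> L * norm (x - y)"
    and "S xt = 0"
    and "gradS xt \<noteq> 0"
    and "B \<ge> 1"
  shows "(\<forall>\<delta>. 0 < \<delta> \<and> \<delta> < 1 \<and> cball xt \<delta> \<subseteq> U \<longrightarrow>
            cos_angle (expected_grad_est S xt \<delta> B) (gradS xt)
              \<ge> 1 - 9 * L\<^sup>2 * \<delta>\<^sup>2 * (real DIM('a))\<^sup>2 / (8 * (norm (gradS xt))\<^sup>2))
       \<and> ((\<lambda>\<delta>. cos_angle (expected_grad_est S xt \<delta> B) (gradS xt)) \<longlongrightarrow> 1) (at_right 0)"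
proof (intro conjI allI impI)
  let ?lb = "\<lambda>\<delta>. 1 - 9 * L\<^sup>2 * \<delta>\<^sup>2 * (real DIM('a))\<^sup>2 / (8 * (norm (gradS xt))\<^sup>2)"
  have lb: "?lb \<delta> \<le> cos_angle (expected_grad_est S xt \<delta> B) (gradS xt)"
    if "0 < \<delta>" "cball xt \<delta> \<subseteq> U" for \<delta>
    using cos_expected_grad_est_ge[OF assms(3-7) that] .
  then show "?lb \<delta> \<le> cos_angle (expected_grad_est S xt \<delta> B) (gradS xt)"
    if "0 < \<delta> \<and> \<delta> < 1 \<and> cball xt \<delta> \<subseteq> U" for \<delta>
    using that by blast
  \<comment> \<open>Openness of U makes the lower bound available for all sufficiently small radii,
    as the limit requires.\<close>
  obtain r where r: "0 < r" "cball xt r \<subseteq> U"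
    using assms(1,2) by (meson open_contains_cball)
  show "((\<lambda>\<delta>. cos_angle (expected_grad_est S xt \<delta> B) (gradS xt)) \<longlongrightarrow> 1) (at_right 0)"
  proof (rule tendsto_sandwich)
    have "eventually (\<lambda>\<delta>. \<delta> \<in> {0<..<r}) (at_right 0)"
      using r(1) by (rule eventually_at_right_real)
    then show "eventually (\<lambda>\<delta>. ?lb \<delta> \<le> cos_angle (expected_grad_est S xt \<delta> B) (gradS xt)) (at_right 0)"
    proof eventually_elim
      case (elim \<delta>)
      then have "cball xt \<delta> \<subseteq> U"
        using r(2) subset_cball[of \<delta> r xt] by auto
      then show ?case
        using elim lb by simp
    qed
    have "(?lb \<longlongrightarrow> ?lb 0) (at_right 0)"
      using assms(6) by (intro tendsto_intros) auto
    then show "(?lb \<longlongrightarrow> 1) (at_right 0)"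
      by simp
  qed (auto simp: cos_angle_le_1)
qed

end
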